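(* Let $P$ be a left skew-prepoloid with unique local left units, and let $P[\mathsf{m}]$ be the set $P$ equipped with the restricted partial binary operation $\mathsf{m}:(x,y)\mapsto x\cdot y$, where $x\cdot y$ is defined if and only if $x\lambda_y$ is defined and $x\lambda_y=x$, in which case $x\cdot y=xy$. Then $P[\mathsf{m}]$ is a left skew-poloid.
   Context: A magmoid is a non-empty set $P$ with a non-empty partial binary operation $(x,y)\mapsto xy$. A compound product such as $(xy)z$ is defined iff $xy$ is defined and the product of $xy$ with $z$ is defined (similarly for $x(yz)$). An asserted equation between products includes the assertion that both sides are defined. A left semigroupoid is a magmoid $P$ such that for all $x,y,z\in P$: if $x(yz)$ is defined, or if both $xy$ and $yz$ are defined, then $x(yz)=(xy)z$ (both sides defined). A local left unit for $x$ is some $\lambda_x$ with $\lambda_x x=x$ (product defined). A left skew-prepoloid is a left semigroupoid in which every element has a local left unit; it has unique local left units if every $x$ has exactly one local left unit, denoted $\lambda_x$. (In a left skew-prepoloid, if $x\lambda_y$ is defined then $xy$ is defined, so the restricted operation is well defined.) A right unit in a magmoid $Q$ is some $\varepsilon\in Q$ such that for every $y\in Q$, if $y\varepsilon$ is defined then $y\varepsilon=y$. A twisted left unit for $x\in Q$ is a local left unit for $x$ that is also a right unit in $Q$. A left skew-poloid is a left semigroupoid in which every element $x$ has a unique twisted left unit $\varphi_x$. *)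

theory Defs
  imports Main
begin

text \<open>
  A partial binary operation on a set \<open>P\<close> is a function into the option type; \<open>mul x y = None\<close> means
  that \<open>xy\<close> is undefined. Products are defined for elements of \<open>P\<close> only, so \<open>mul\<close> carries exactly
  the data of a partial map from \<open>P \<times> P\<close> to \<open>P\<close>.
\<close>

locale magmoid =
  fixes P :: "'a set" and mul :: "'a \<Rightarrow> 'a \<Rightarrow> 'a option"
  assumes carrier_nonempty: "P \<noteq> {}"
    and mul_nonempty: "\<exists>x y. mul x y \<noteq> None"
    and mul_in_carrier: "mul x y = Some z \<Longrightarrow> x \<in> P \<and> y \<in> P \<and> z \<in> P"

text \<open>The compound products \<open>x(yz)\<close> and \<open>(xy)z\<close>.\<close>

definition mul_r :: "('a \<Rightarrow> 'a \<Rightarrow> 'a option) \<Rightarrow> 'a \<Rightarrow> 'a \<Rightarrow> 'a \<Rightarrow> 'a option" where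
  "mul_r mul x y z = Option.bind (mul y z) (\<lambda>w. mul x w)"

definition mul_l :: "('a \<Rightarrow> 'a \<Rightarrow> 'a option) \<Rightarrow> 'a \<Rightarrow> 'a \<Rightarrow> 'a \<Rightarrow> 'a option" where
  "mul_l mul x y z = Option.bind (mul x y) (\<lambda>w. mul w z)"

locale left_semigroupoid = magmoid +
  assumes left_assoc:
    "\<lbrakk>x \<in> P; y \<in> P; z \<in> P;
      mul_r mul x y z \<noteq> None \<or> (mul x y \<noteq> None \<and> mul y z \<noteq> None)\<rbrakk>
     \<Longrightarrow> \<exists>w. mul_r mul x y z = Some w \<and> mul_l mul x y z = Some w"

definition local_left_unit :: "'a set \<Rightarrow> ('a \<Rightarrow> 'a \<Rightarrow> 'a option) \<Rightarrow> 'a \<Rightarrow> 'a \<Rightarrow> bool" where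
  "local_left_unit P mul l x \<longleftrightarrow> l \<in> P \<and> mul l x = Some x"

definition right_unit :: "'a set \<Rightarrow> ('a \<Rightarrow> 'a \<Rightarrow> 'a option) \<Rightarrow> 'a \<Rightarrow> bool" where
  "right_unit P mul e \<longleftrightarrow> e \<in> P \<and> (\<forall>y\<in>P. mul y e \<noteq> None \<longrightarrow> mul y e = Some y)"

definition twisted_left_unit :: "'a set \<Rightarrow> ('a \<Rightarrow> 'a \<Rightarrow> 'a option) \<Rightarrow> 'a \<Rightarrow> 'a \<Rightarrow> bool" where
  "twisted_left_unit P mul l x \<longleftrightarrow> local_left_unit P mul l x \<and> right_unit P mul l"

locale left_skew_prepoloid = left_semigroupoid +
  assumes ex_local_left_unit: "x \<in> P \<Longrightarrow> \<exists>l. local_left_unit P mul l x"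

locale left_skew_prepoloid_unique = left_skew_prepoloid +
  assumes ex1_local_left_unit: "x \<in> P \<Longrightarrow> \<exists>!l. local_left_unit P mul l x"

locale left_skew_poloid = left_semigroupoid +
  assumes ex1_twisted_left_unit: "x \<in> P \<Longrightarrow> \<exists>!l. twisted_left_unit P mul l x"

text \<open>The element \<open>\<lambda>\<^sub>x\<close>; meaningful only where local left units are unique.\<close>

definition the_left_unit :: "'a set \<Rightarrow> ('a \<Rightarrow> 'a \<Rightarrow> 'a option) \<Rightarrow> 'a \<Rightarrow> 'a" where
  "the_left_unit P mul x = (THE l. local_left_unit P mul l x)"

definition restricted_mul ::
  "'a set \<Rightarrow> ('a \<Rightarrow> 'a \<Rightarrow> 'a option) \<Rightarrow> 'a \<Rightarrow> 'a \<Rightarrow> 'a option" where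
  "restricted_mul P mul x y =
     (if x \<in> P \<and> y \<in> P \<and> mul x (the_left_unit P mul y) = Some x then mul x y else None)"

text \<open>
  The first branch of \<^const>\<open>restricted_mul\<close> never yields \<open>None\<close>, so \<open>x \<cdot> y\<close> is defined
  exactly when \<open>x\<lambda>\<^sub>y\<close> is defined and equal to \<open>x\<close>.
\<close>

lemma (in left_skew_prepoloid_unique) restricted_mul_defined_iff:
  assumes "x \<in> P" "y \<in> P"
  shows "restricted_mul P mul x y \<noteq> None \<longleftrightarrow> mul x (the_left_unit P mul y) = Some x"
proof -
  let ?l = "the_left_unit P mul y"
  have "local_left_unit P mul ?l y"
    unfolding the_left_unit_def by (rule theI') (rule ex1_local_left_unit[OF assms(2)])
  then have l: "?l \<in> P" "mul ?l y = Some y"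
    by (simp_all add: local_left_unit_def)
  have "mul x y \<noteq> None" if "mul x ?l = Some x"
    using left_assoc[OF assms(1) l(1) assms(2)] that l(2)
    by (auto simp: mul_r_def)
  then show ?thesis
    using assms by (auto simp: restricted_mul_def)
qed

end

theory Submission
  imports Defs
begin

text \<open>
  Uniqueness of local left units forces \<open>\<lambda>\<^sub>x\<close> to be its own local left unit (hence idempotent) and
  \<open>\<lambda>\<^bsub>xy\<^esub> = \<lambda>\<^sub>x\<close>: \<open>\<lambda>\<^bsub>\<lambda>\<^sub>x\<^esub>\<close> is a local left unit of \<open>x\<close> and \<open>\<lambda>\<^sub>x\<close> one of \<open>xy\<close>.
  The second identity makes \<open>x \<cdot> (y \<cdot> z)\<close> defined iff \<open>x \<cdot> y\<close> and \<open>y \<cdot> z\<close>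
  are, and the first makes \<open>\<lambda>\<^sub>x\<close> a right unit for the restricted operation.
\<close>

context left_semigroupoid
begin

text \<open>This lemma and the next split the two alternatives of \<open>left_assoc\<close> and
  unpack the option-valued compound products.\<close>

lemma assoc_if_right_product:
  assumes "mul y z = Some v" "mul x v = Some w"
  obtains u where "mul x y = Some u" "mul u z = Some w"
proof -
  have "x \<in> P" "y \<in> P" "z \<in> P"
    using assms mul_in_carrier by blast+
  with assms left_assoc[of x y z] that show thesis
    by (auto simp: mul_r_def mul_l_def bind_eq_Some_conv)
qed

lemma assoc_if_both_products:
  assumes "mul x y = Some u" "mul y z = Some v"
  obtains w where "mul x v = Some w" "mul u z = Some w"
proof -
  have "x \<in> P" "y \<in> P" "z \<in> P"
    using assms mul_in_carrier by blast+
  with assms left_assoc[of x y z] that show thesis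
    by (auto simp: mul_r_def mul_l_def)
qed

end

context left_skew_prepoloid_unique
begin

abbreviation unit_of :: "'a \<Rightarrow> 'a" where
  "unit_of \<equiv> the_left_unit P mul"

lemma local_left_unit_unit_of:
  assumes "x \<in> P"
  shows "local_left_unit P mul (unit_of x) x"
  unfolding the_left_unit_def by (rule theI') (rule ex1_local_left_unit[OF assms])

lemma unit_of_in_carrier: "x \<in> P \<Longrightarrow> unit_of x \<in> P"
  and mul_unit_of: "x \<in> P \<Longrightarrow> mul (unit_of x) x = Some x"
  using local_left_unit_unit_of by (simp_all add: local_left_unit_def)

lemma unit_of_eqI:
  assumes "mul l x = Some x"
  shows "unit_of x = l"
proof -
  have "l \<in> P" "x \<in> P"
    using assms mul_in_carrier by blast+
  with assms show ?thesis
    using ex1_local_left_unit local_left_unit_unit_of by (auto simp: local_left_unit_def)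
qed

lemma unit_of_unit_of:
  assumes "x \<in> P"
  shows "unit_of (unit_of x) = unit_of x"
proof -
  have "mul (unit_of (unit_of x)) (unit_of x) = Some (unit_of x)" "mul (unit_of x) x = Some x"
    using assms mul_unit_of unit_of_in_carrier by blast+
  \<comment> \<open>With e = \<open>unit_of x\<close> and f = \<open>unit_of e\<close>: fx = f(ex) =
    (fe)x = ex = x.\<close>
  then have "mul (unit_of (unit_of x)) x = Some x"
    by (rule assoc_if_both_products) (simp add: mul_unit_of assms)
  then show ?thesis
    using unit_of_eqI by metis
qed

lemma unit_of_mul:
  assumes "mul x y = Some z"
  shows "unit_of z = unit_of x"
proof -
  have "mul (unit_of x) x = Some x"
    using assms mul_in_carrier mul_unit_of by blast
  \<comment> \<open>With e = \<open>unit_of x\<close>: e(xy) = (ex)y = xy.\<close>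
  then have "mul (unit_of x) z = Some z"
    using assms by (rule assoc_if_both_products) (use assms in simp)
  then show ?thesis
    by (rule unit_of_eqI)
qed

lemma restricted_mul_eq_Some_iff:
  "restricted_mul P mul x y = Some z \<longleftrightarrow> mul x (unit_of y) = Some x \<and> mul x y = Some z"
  using mul_in_carrier by (auto simp: restricted_mul_def)

text \<open>The side condition here is idempotence of \<open>unit_of x\<close>, which holds because
  this element is its own unit.\<close>

lemma restricted_mul_unit_of:
  assumes "x \<in> P"
  shows "restricted_mul P mul (unit_of x) x = Some x"
  using mul_unit_of[OF assms] mul_unit_of[OF unit_of_in_carrier[OF assms]] unit_of_unit_of[OF assms]
  by (simp add: restricted_mul_eq_Some_iff)

lemma restricted_mul_assoc:
  assumes xy: "restricted_mul P mul x y = Some u" and yz: "restricted_mul P mul y z = Some v"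
  obtains w where "restricted_mul P mul x v = Some w" "restricted_mul P mul u z = Some w"
proof -
  note xy' = xy[unfolded restricted_mul_eq_Some_iff] and yz' = yz[unfolded restricted_mul_eq_Some_iff]
  obtain w where w: "mul x v = Some w" "mul u z = Some w"
    using assoc_if_both_products xy' yz' by metis
  \<comment> \<open>With e = \<open>unit_of z\<close>, ye = y gives (xy)e = x(ye) = xy.\<close>
  have "mul u (unit_of z) = Some u"
    using assoc_if_both_products[of x y u "unit_of z" y] xy' yz' by auto
  \<comment> \<open>As v = yz, its unit is that of y, which x absorbs by \<open>xy\<close>.\<close>
  moreover have "mul x (unit_of v) = Some x"
    using unit_of_mul[of y z v] xy' yz' by simp
  ultimately show thesis
    using that w by (simp add: restricted_mul_eq_Some_iff)
qed

text \<open>Reduces the first alternative of left associativity to the second: v = yz and y share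
  their unit, so the side condition transfers from v to y.\<close>

lemma restricted_mul_left_factor_defined:
  assumes "restricted_mul P mul y z = Some v" "restricted_mul P mul x v = Some w"
  shows "\<exists>u. restricted_mul P mul x y = Some u"
proof -
  have "mul x (unit_of y) = Some x"
    using assms unit_of_mul[of y z v] by (simp add: restricted_mul_eq_Some_iff)
  moreover obtain u where "mul x y = Some u"
    using assms assoc_if_right_product unfolding restricted_mul_eq_Some_iff by metis
  ultimately show ?thesis
    by (simp add: restricted_mul_eq_Some_iff)
qed

text \<open>The side condition for a product with \<open>unit_of x\<close> on the right involves the
  unit of \<open>unit_of x\<close>, that is \<open>unit_of x\<close> itself.\<close>

lemma right_unit_unit_of:
  assumes "x \<in> P"
  shows "right_unit P (restricted_mul P mul) (unit_of x)"
  using assms unit_of_in_carrier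
  by (auto simp: right_unit_def restricted_mul_eq_Some_iff unit_of_unit_of)

end

theorem theorem8p4:
  fixes P :: "'a set" and mul :: "'a \<Rightarrow> 'a \<Rightarrow> 'a option"
  assumes "left_skew_prepoloid_unique P mul"
  shows "left_skew_poloid P (restricted_mul P mul)"
proof -
  interpret left_skew_prepoloid_unique P mul
    by fact
  let ?m = "restricted_mul P mul"
  show ?thesis
  proof unfold_locales
    show "P \<noteq> {}"
      by (rule carrier_nonempty)
    then show "\<exists>x y. ?m x y \<noteq> None"
      using restricted_mul_unit_of by blast
  next
    fix x y z assume "?m x y = Some z"
    then show "x \<in> P \<and> y \<in> P \<and> z \<in> P"
      using mul_in_carrier by (auto simp: restricted_mul_eq_Some_iff)
  next
    fix x y z
    assume "mul_r ?m x y z \<noteq> None \<or> (?m x y \<noteq> None \<and> ?m y z \<noteq> None)"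
    then obtain u v where uv: "?m x y = Some u" "?m y z = Some v"
      using restricted_mul_left_factor_defined
      by (auto simp: mul_r_def bind_eq_Some_conv) blast
    then obtain w where "?m x v = Some w" "?m u z = Some w"
      by (rule restricted_mul_assoc)
    with uv show "\<exists>w. mul_r ?m x y z = Some w \<and> mul_l ?m x y z = Some w"
      by (simp add: mul_r_def mul_l_def)
  next
    fix x assume x: "x \<in> P"
    show "\<exists>!l. twisted_left_unit P ?m l x"
    proof
      show "twisted_left_unit P ?m (unit_of x) x"
        using x unit_of_in_carrier restricted_mul_unit_of right_unit_unit_of
        by (simp add: twisted_left_unit_def local_left_unit_def)
    next
      fix l assume "twisted_left_unit P ?m l x"
      \<comment> \<open>A local left unit for \<open>?m\<close> is also one for \<open>mul\<close>,
        where it is unique.\<close>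
      then show "l = unit_of x"
        using unit_of_eqI
        by (auto simp: twisted_left_unit_def local_left_unit_def restricted_mul_eq_Some_iff)
    qed
  qed
qed

end
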